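(* Let $n$ be a nonnegative integer. For every integer $p\ge 1$, the mapping $\Pi_{n+p}:\Lambda_{n+p}\to\Lambda_n$ defined by setting $\mathbf x_{n+1}=0,\ \mathbf x_{n+2}=0,\ \dots,\ \mathbf x_{n+p}=0$ is a surjective homomorphism of graded rings. Furthermore, the restriction $$\Pi_{n+p}^r:=\Pi_{n+p}|_{\Lambda_{n+p}^r}:\Lambda_{n+p}^r\to\Lambda_n^r$$ is surjective for all $r\ge 0$, and is an isomorphism if and only if $r\le n$.
   Context: $\Lambda_n=\mathbb Z[\mathbf x_1,\dots,\mathbf x_n]^{S_n}$ is the graded ring of symmetric polynomials with integer coefficients in $n$ independent indeterminates, and $\Lambda_n^r$ is the additive group of homogeneous symmetric polynomials of degree $r$ in $\mathbf x_1,\dots,\mathbf x_n$ (with $0$ homogeneous of every degree), so that $\Lambda_n=\bigoplus_{r\ge0}\Lambda_n^r$ and $\Lambda_n^0=\mathbb Z$. For $n=0$, $\Lambda_0=\mathbb Z$. *)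

theory Defs
  imports
    "HOL-Library.Poly_Mapping"
    "HOL-Combinatorics.Permutations"
    "HOL-Algebra.RingHom"
begin

text \<open>A commutative ring \<open>R\<close> graded by the nonnegative integers: \<open>R\<close> is the internal direct sum
  of the additive subgroups \<open>A r\<close>, and \<open>A r \<cdot> A s \<subseteq> A (r + s)\<close>.\<close>

locale graded_cring = cring R for R (structure) +
  fixes A :: "nat \<Rightarrow> 'a set"
  assumes additive_subgroup_component: "additive_subgroup (A r) R"
    and direct_sum: "x \<in> carrier R \<Longrightarrow>
      \<exists>!a. (\<forall>r. a r \<in> A r) \<and> finite {r. a r \<noteq> \<zero>} \<and> x = (\<Oplus>r\<in>{r. a r \<noteq> \<zero>}. a r)"
    and graded_mult: "x \<in> A r \<Longrightarrow> y \<in> A s \<Longrightarrow> x \<otimes> y \<in> A (r + s)"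

locale graded_cring_hom =
  R: graded_cring R A + S: graded_cring S B + ring_hom_cring R S h
  for R :: "('a, 'c) ring_scheme" (structure) and A
    and S :: "('b, 'd) ring_scheme" (structure) and B and h +
  assumes hom_component: "x \<in> A r \<Longrightarrow> h x \<in> B r"

text \<open>A monomial is a finitely supported family of exponents, and a polynomial is a finitely
  supported family of coefficients indexed by monomials. The type has the indeterminates
  \<open>x i\<close> for all natural numbers \<open>i\<close>; only those with \<open>i \<ge> 1\<close> are used below.\<close>

type_synonym int_poly = "(nat \<Rightarrow>\<^sub>0 nat) \<Rightarrow>\<^sub>0 int"

definition indet :: "nat \<Rightarrow> int_poly" where
  "indet i = Poly_Mapping.single (Poly_Mapping.single i 1) 1"

definition polys :: "nat \<Rightarrow> int_poly set" where
  "polys n = {f. \<forall>m\<in>Poly_Mapping.keys f. Poly_Mapping.keys m \<subseteq> {1..n}}"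

definition homogeneous :: "nat \<Rightarrow> int_poly \<Rightarrow> bool" where
  "homogeneous r f \<longleftrightarrow>
     (\<forall>m\<in>Poly_Mapping.keys f. (\<Sum>i\<in>Poly_Mapping.keys m. Poly_Mapping.lookup m i) = r)"

text \<open>The result of substituting \<open>\<sigma> i\<close> for the indeterminate \<open>x i\<close>, for all \<open>i\<close> simultaneously.\<close>

definition poly_subst :: "(nat \<Rightarrow> int_poly) \<Rightarrow> int_poly \<Rightarrow> int_poly" where
  "poly_subst \<sigma> f =
     (\<Sum>m\<in>Poly_Mapping.keys f.
        of_int (Poly_Mapping.lookup f m) *
        (\<Prod>i\<in>Poly_Mapping.keys m. \<sigma> i ^ Poly_Mapping.lookup m i))"

definition sym_polys :: "nat \<Rightarrow> int_poly set" where
  "sym_polys n =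
     {f \<in> polys n. \<forall>\<pi>. \<pi> permutes {1..n} \<longrightarrow> poly_subst (\<lambda>i. indet (\<pi> i)) f = f}"

definition sym_ring :: "nat \<Rightarrow> int_poly ring" where
  "sym_ring n =
     \<lparr>carrier = sym_polys n, monoid.mult = (*), one = 1, ring.zero = 0, add = (+)\<rparr>"

definition sym_homog :: "nat \<Rightarrow> nat \<Rightarrow> int_poly set" where
  "sym_homog n r = {f \<in> sym_polys n. homogeneous r f}"

definition sym_homog_group :: "nat \<Rightarrow> nat \<Rightarrow> int_poly monoid" where
  "sym_homog_group n r = \<lparr>carrier = sym_homog n r, monoid.mult = (+), one = 0\<rparr>"

definition sym_proj :: "nat \<Rightarrow> nat \<Rightarrow> int_poly \<Rightarrow> int_poly" where
  "sym_proj n p = poly_subst (\<lambda>i. if i \<in> {n + 1..n + p} then 0 else indet i)"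

end

(* A polynomial supported on x_1, ..., x_n is symmetric iff its coefficients depend only on the
   multiset of nonzero exponents (the shape) of a monomial. Shapes make no reference to n, so a
   coefficient function on shapes defines a symmetric polynomial in any number of indeterminates,
   and setting the last p of them to zero forgets exactly the shapes with more than n parts. This
   gives surjectivity. A shape of degree r has at most r parts, so nothing is forgotten if r <= n,
   while for r > n the shape (r - n, 1, ..., 1) with n + 1 parts is. *)
theory Submission
  imports Defs
begin

abbreviation lookup :: "('a \<Rightarrow>\<^sub>0 'b::zero) \<Rightarrow> 'a \<Rightarrow> 'b" where
  "lookup \<equiv> Poly_Mapping.lookup"

abbreviation keys :: "('a \<Rightarrow>\<^sub>0 'b::zero) \<Rightarrow> 'a set" where
  "keys \<equiv> Poly_Mapping.keys"

abbreviation single :: "'a \<Rightarrow> 'b::zero \<Rightarrow> 'a \<Rightarrow>\<^sub>0 'b" where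
  "single \<equiv> Poly_Mapping.single"

abbreviation map_key :: "('b \<Rightarrow> 'a) \<Rightarrow> ('a \<Rightarrow>\<^sub>0 'c::zero) \<Rightarrow> 'b \<Rightarrow>\<^sub>0 'c" where
  "map_key \<equiv> Poly_Mapping.map_key"


section \<open>Substitution\<close>

definition mono_subst :: "(nat \<Rightarrow> int_poly) \<Rightarrow> (nat \<Rightarrow>\<^sub>0 nat) \<Rightarrow> int_poly" where
  "mono_subst \<sigma> m = (\<Prod>i\<in>keys m. \<sigma> i ^ lookup m i)"

text \<open>Indices outside the support contribute the factor \<open>\<sigma> i ^ 0 = 1\<close>.
  This permits comparing several monomials over one common index set.\<close>

lemma mono_subst_superset:
  assumes "finite K" "keys m \<subseteq> K"
  shows "mono_subst \<sigma> m = (\<Prod>i\<in>K. \<sigma> i ^ lookup m i)"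
  unfolding mono_subst_def
  by (rule prod.mono_neutral_left) (use assms in \<open>auto simp: in_keys_iff\<close>)

lemma mono_subst_add: "mono_subst \<sigma> (m + m') = mono_subst \<sigma> m * mono_subst \<sigma> m'"
proof -
  let ?K = "keys m \<union> keys m'"
  have "keys (m + m') \<subseteq> ?K" by (rule Poly_Mapping.keys_add)
  then show ?thesis
    by (simp add: mono_subst_superset[of ?K] lookup_add power_add prod.distrib)
qed

lemma poly_subst_superset:
  assumes "finite K" "keys f \<subseteq> K"
  shows "poly_subst \<sigma> f = (\<Sum>m\<in>K. of_int (lookup f m) * mono_subst \<sigma> m)"
  unfolding poly_subst_def mono_subst_def
  by (rule sum.mono_neutral_left) (use assms in \<open>auto simp: in_keys_iff\<close>)

lemma poly_subst_add: "poly_subst \<sigma> (f + g) = poly_subst \<sigma> f + poly_subst \<sigma> g"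
proof -
  let ?K = "keys f \<union> keys g"
  have "keys (f + g) \<subseteq> ?K" by (rule Poly_Mapping.keys_add)
  then show ?thesis
    by (simp add: poly_subst_superset[of ?K] lookup_add distrib_right sum.distrib)
qed

lemma poly_subst_0 [simp]: "poly_subst \<sigma> 0 = 0"
  by (simp add: poly_subst_def)

lemma poly_subst_uminus: "poly_subst \<sigma> (- f) = - poly_subst \<sigma> f"
  using poly_subst_add[of \<sigma> f "- f"] by (simp add: eq_neg_iff_add_eq_0 add.commute)

lemma poly_subst_sum: "poly_subst \<sigma> (sum F K) = (\<Sum>k\<in>K. poly_subst \<sigma> (F k))"
  by (induction K rule: infinite_finite_induct) (auto simp: poly_subst_add)

lemma poly_subst_single: "poly_subst \<sigma> (single m c) = of_int c * mono_subst \<sigma> m"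
  by (subst poly_subst_superset[of "{m}"]) auto

lemma poly_subst_1 [simp]: "poly_subst \<sigma> 1 = 1"
  using poly_subst_single[of \<sigma> 0 1] by (simp add: mono_subst_def)

lemma sum_single_lookup: "(\<Sum>k\<in>keys f. single k (lookup f k)) = f"
  by (rule poly_mapping_eqI) (simp add: lookup_sum lookup_single when_def in_keys_iff)

text \<open>Both factors are expanded into single terms, which reduces the claim to
  \<open>mono_subst_add\<close>. It yields closure of symmetric polynomials under products and
  multiplicativity of the projection.\<close>

lemma poly_subst_mult: "poly_subst \<sigma> (f * g) = poly_subst \<sigma> f * poly_subst \<sigma> g"
proof -
  have "f * g = (\<Sum>k\<in>keys f. single k (lookup f k)) * (\<Sum>l\<in>keys g. single l (lookup g l))"
    by (simp add: sum_single_lookup)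
  also have "\<dots> = (\<Sum>k\<in>keys f. \<Sum>l\<in>keys g. single (k + l) (lookup f k * lookup g l))"
    by (simp add: sum_product mult_single)
  also have "poly_subst \<sigma> \<dots> =
      (\<Sum>k\<in>keys f. \<Sum>l\<in>keys g. (of_int (lookup f k) * mono_subst \<sigma> k) * (of_int (lookup g l) * mono_subst \<sigma> l))"
    by (simp add: poly_subst_sum poly_subst_single mono_subst_add mult_ac)
  also have "\<dots> = poly_subst \<sigma> f * poly_subst \<sigma> g"
    by (simp add: poly_subst_superset[OF finite_keys order_refl] sum_product)
  finally show ?thesis .
qed

section \<open>Permuting the indeterminates\<close>

lemma of_int_times_single: "of_int c * single m 1 = (single m c :: int_poly)"
proof -
  have "of_int c = (single 0 c :: int_poly)"
    using single_of_int[of c] by (metis of_int_eq_id id_apply)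
  then show ?thesis by (simp add: mult_single)
qed

lemma indet_power: "indet i ^ k = single (single i k) 1"
  by (induction k) (auto simp: indet_def mult_single single_add[symmetric])

lemma prod_single: "(\<Prod>i\<in>K. single (g i) (1::int)) = single (\<Sum>i\<in>K. g i) 1"
  by (induction K rule: infinite_finite_induct) (auto simp: mult_single)

lemma lookup_map_key: "inj f \<Longrightarrow> lookup (map_key f m) i = lookup m (f i)"
  by (simp add: Poly_Mapping.map_key.rep_eq)

text \<open>The inverse appears because the exponent at \<open>i\<close> moves to
  \<open>\<pi> i\<close>, so the new exponent at \<open>j\<close> is the old one at the preimage of
  \<open>j\<close>.\<close>

lemma mono_subst_perm:
  assumes "bij \<pi>"
  shows "mono_subst (\<lambda>i. indet (\<pi> i)) m = single (map_key (Hilbert_Choice.inv \<pi>) m) 1"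
proof -
  have "inj (Hilbert_Choice.inv \<pi>)" using assms by (simp add: bij_imp_bij_inv bij_is_inj)
  have "(\<Sum>i\<in>keys m. single (\<pi> i) (lookup m i)) = map_key (Hilbert_Choice.inv \<pi>) m"
  proof (rule poly_mapping_eqI)
    fix j
    have "\<pi> i = j \<longleftrightarrow> i = Hilbert_Choice.inv \<pi> j" for i
      using assms by (metis bij_inv_eq_iff)
    then show "lookup (\<Sum>i\<in>keys m. single (\<pi> i) (lookup m i)) j = lookup (map_key (Hilbert_Choice.inv \<pi>) m) j"
      using \<open>inj (Hilbert_Choice.inv \<pi>)\<close>
      by (simp add: lookup_sum lookup_single when_def lookup_map_key in_keys_iff)
  qed
  then show ?thesis by (simp add: mono_subst_def indet_power prod_single)
qed

lemma map_key_inv_eq_iff: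
  assumes "bij \<pi>"
  shows "map_key (Hilbert_Choice.inv \<pi>) m = m' \<longleftrightarrow> m = map_key \<pi> m'"
proof -
  have "inj \<pi>" "inj (Hilbert_Choice.inv \<pi>)"
    using assms by (auto simp: bij_imp_bij_inv bij_is_inj)
  then show ?thesis
    using assms by (auto simp: poly_mapping_eq_iff fun_eq_iff lookup_map_key)
      (metis bij_inv_eq_iff)+
qed

text \<open>Exactly one monomial is sent to \<open>m\<close>, namely \<open>map_key \<pi> m\<close>.
  Symmetry thereby becomes invariance of the coefficient function.\<close>

lemma lookup_poly_subst_perm:
  assumes "bij \<pi>"
  shows "lookup (poly_subst (\<lambda>i. indet (\<pi> i)) f) m = lookup f (map_key \<pi> m)"
  by (simp add: poly_subst_superset[OF finite_keys order_refl] mono_subst_perm[OF assms]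
      of_int_times_single lookup_sum lookup_single when_def map_key_inv_eq_iff[OF assms] in_keys_iff)


section \<open>Symmetric polynomials and shapes of monomials\<close>

text \<open>The shape of a monomial is its partition of exponents, with the zero parts removed. Unlike
  the orbit under the symmetric group, it does not depend on the number of indeterminates.\<close>

definition shape :: "(nat \<Rightarrow>\<^sub>0 nat) \<Rightarrow> nat multiset" where
  "shape m = image_mset (lookup m) (mset_set (keys m))"

lemma size_shape: "size (shape m) = card (keys m)"
  by (simp add: shape_def)

lemma zero_notin_shape: "0 \<notin># shape m"
  by (auto simp: shape_def in_keys_iff)

lemma sum_mset_shape: "sum_mset (shape m) = (\<Sum>i\<in>keys m. lookup m i)"
  by (simp add: shape_def sum_unfold_sum_mset)

lemma homogeneous_shape: "homogeneous r f \<longleftrightarrow> (\<forall>m\<in>keys f. sum_mset (shape m) = r)"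
  by (simp add: homogeneous_def sum_mset_shape)

text \<open>The sum of the shape is the total degree, which is additive once all three sums run over
  the union of the two supports.\<close>

lemma sum_mset_shape_add: "sum_mset (shape (m + m')) = sum_mset (shape m) + sum_mset (shape m')"
proof -
  have *: "sum_mset (shape l) = (\<Sum>i\<in>keys m \<union> keys m'. lookup l i)"
    if "keys l \<subseteq> keys m \<union> keys m'" for l
    unfolding sum_mset_shape
    by (rule sum.mono_neutral_left) (use that in \<open>auto simp: in_keys_iff\<close>)
  show ?thesis
    by (simp add: * Poly_Mapping.keys_add lookup_add sum.distrib)
qed

text \<open>Every part is at least 1. This is the source of the bound \<open>r \<le> n\<close>: a
  shape of degree \<open>r\<close> has at most \<open>r\<close> parts.\<close>

lemma size_le_sum_mset: "0 \<notin># S \<Longrightarrow> size S \<le> sum_mset (S :: nat multiset)"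
  by (induction S) auto

text \<open>The bijection \<open>\<pi>\<close> carries the new support onto the old one and
  preserves exponents along the way.\<close>

lemma shape_map_key:
  assumes "bij \<pi>"
  shows "shape (map_key \<pi> m) = shape m"
proof -
  have "inj \<pi>" using assms by (rule bij_is_inj)
  then have "inj_on \<pi> (\<pi> -` keys m)" by (rule inj_on_subset) simp
  have "shape (map_key \<pi> m) = image_mset (lookup m) (image_mset \<pi> (mset_set (\<pi> -` keys m)))"
    using \<open>inj \<pi>\<close>
    by (simp add: shape_def keys_map_key Poly_Mapping.map_key.rep_eq multiset.map_comp)
  also have "image_mset \<pi> (mset_set (\<pi> -` keys m)) = mset_set (keys m)"
    using assms \<open>inj_on \<pi> (\<pi> -` keys m)\<close>
    by (simp add: image_mset_mset_set bij_is_surj surj_image_vimage_eq)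
  finally show ?thesis by (simp add: shape_def)
qed

text \<open>Padding by zeros to the fixed length \<open>card K\<close> lets shapes be compared
  through exponent families indexed by the same set.\<close>

lemma image_mset_lookup_eq:
  assumes "finite K" "keys m \<subseteq> K"
  shows "image_mset (lookup m) (mset_set K) = shape m + replicate_mset (card K - card (keys m)) 0"
proof -
  have "mset_set K = mset_set (keys m) + mset_set (K - keys m)"
    using assms by (simp add: mset_set_Union[symmetric] Un_absorb1)
  moreover have "image_mset (lookup m) (mset_set (K - keys m))
      = image_mset (\<lambda>_. 0) (mset_set (K - keys m))"
    by (rule image_mset_cong) (use assms in \<open>auto simp: in_keys_iff\<close>)
  ultimately show ?thesis
    using assms by (simp add: shape_def image_mset_const_eq card_Diff_subset)
qed

text \<open>A converse to \<open>shape_map_key\<close>: the zero-padded exponent multisets over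
  \<open>K\<close> agree, so a permutation of \<open>K\<close> matches the exponents, and outside
  \<open>K\<close> both exponents vanish.\<close>

lemma shape_eq_imp_permutes:
  assumes "finite K" "keys m \<subseteq> K" "keys m' \<subseteq> K" "shape m = shape m'"
  obtains \<pi> where "\<pi> permutes K" "m = map_key \<pi> m'"
proof -
  have "card (keys m) = card (keys m')"
    using assms(4) by (metis size_shape)
  then have "image_mset (lookup m) (mset_set K) = image_mset (lookup m') (mset_set K)"
    using assms by (simp add: image_mset_lookup_eq)
  then obtain \<pi> where \<pi>: "\<pi> permutes K" "\<forall>x\<in>K. lookup m x = lookup m' (\<pi> x)"
    using image_mset_eq_implies_permutes[OF assms(1)] by blast
  have "lookup m x = lookup m' (\<pi> x)" for x
  proof (cases "x \<in> K")
    case False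
    then have "x \<notin> keys m" "x \<notin> keys m'" "\<pi> x = x"
      using assms \<pi>(1) by (auto simp: permutes_not_in)
    then show ?thesis by (simp add: in_keys_iff)
  qed (use \<pi> in auto)
  moreover have "inj \<pi>" using \<pi>(1) by (rule permutes_inj)
  ultimately have "m = map_key \<pi> m'"
    by (intro poly_mapping_eqI) (simp add: lookup_map_key)
  with \<pi>(1) show ?thesis by (rule that)
qed

text \<open>The parts, listed in any order, serve as the exponents of the first
  \<open>size S\<close> indeterminates.\<close>

lemma exists_monomial_of_shape:
  assumes "0 \<notin># S" "size S \<le> n"
  obtains m where "keys m \<subseteq> {1..n}" "shape m = S"
proof -
  obtain xs where xs: "mset xs = S" by (metis ex_mset)
  \<comment> \<open>The shift by one reconciles list positions, which start at 0, with
    indeterminates, which start at 1.\<close>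
  define g where "g i = (if i \<in> {1..length xs} then xs ! (i - 1) else 0)" for i
  have "xs ! i \<noteq> 0" if "i < length xs" for i
    using assms(1) xs that by (metis nth_mem set_mset_mset)
  then have g0: "{i. g i \<noteq> 0} = {1..length xs}"
    by (auto simp: g_def)
  define m where "m = Abs_poly_mapping g"
  have m: "lookup m = g"
    unfolding m_def by (rule Abs_poly_mapping_inverse) (simp only: g0 mem_Collect_eq finite_atLeastAtMost)
  then have keys: "keys m = {1..length xs}"
    using g0 by (auto simp: in_keys_iff set_eq_iff)
  have "{1..length xs} = Suc ` {..<length xs}"
    by (simp add: lessThan_atLeast0 image_Suc_atLeastLessThan atLeastLessThanSuc_atLeastAtMost)
  then have "mset_set (keys m) = image_mset Suc (mset_set {..<length xs})"
    by (simp add: keys image_mset_mset_set)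
  then have "shape m = image_mset (\<lambda>i. g (Suc i)) (mset_set {..<length xs})"
    by (simp add: shape_def m multiset.map_comp comp_def)
  also have "\<dots> = image_mset ((!) xs) (mset_set {..<length xs})"
    by (rule image_mset_cong) (auto simp: g_def)
  also have "\<dots> = mset (map ((!) xs) [0..<length xs])"
    by (simp add: lessThan_atLeast0)
  also have "\<dots> = S" by (simp only: map_nth xs)
  finally have "shape m = S" .
  moreover have "keys m \<subseteq> {1..n}"
    using keys assms(2) xs by auto
  ultimately show ?thesis by (rule that[rotated])
qed

section \<open>Symmetry as constancy of coefficients on shapes\<close>

lemma polysD: "f \<in> polys n \<Longrightarrow> \<not> keys m \<subseteq> {1..n} \<Longrightarrow> lookup f m = 0"
  by (auto simp: polys_def in_keys_iff)

lemma polysI: "(\<And>m. lookup f m \<noteq> 0 \<Longrightarrow> keys m \<subseteq> {1..n}) \<Longrightarrow> f \<in> polys n"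
  by (simp add: polys_def in_keys_iff)

lemma sym_polys_iff_map_key:
  "f \<in> sym_polys n \<longleftrightarrow> f \<in> polys n \<and> (\<forall>\<pi> m. \<pi> permutes {1..n} \<longrightarrow> lookup f (map_key \<pi> m) = lookup f m)"
  by (auto simp: sym_polys_def poly_mapping_eq_iff fun_eq_iff lookup_poly_subst_perm permutes_bij)

text \<open>The orbits of monomials in \<open>n\<close> indeterminates under permutation are exactly
  the classes of equal shape, by \<open>shape_eq_imp_permutes\<close> and
  \<open>shape_map_key\<close>.\<close>

lemma sym_polys_iff_shape:
  "f \<in> sym_polys n \<longleftrightarrow> f \<in> polys n \<and>
     (\<forall>m m'. keys m \<subseteq> {1..n} \<longrightarrow> keys m' \<subseteq> {1..n} \<longrightarrow> shape m = shape m' \<longrightarrow> lookup f m = lookup f m')"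
proof (intro iffI conjI allI impI)
  assume f: "f \<in> sym_polys n"
  then show "f \<in> polys n" by (simp add: sym_polys_def)
  fix m m' assume "keys m \<subseteq> {1..n}" "keys m' \<subseteq> {1..n}" "shape m = shape m'"
  then obtain \<pi> where "\<pi> permutes {1..n}" "m = map_key \<pi> m'"
    using shape_eq_imp_permutes[OF finite_atLeastAtMost] by blast
  then show "lookup f m = lookup f m'"
    using f by (simp add: sym_polys_iff_map_key)
next
  assume f: "f \<in> polys n \<and> (\<forall>m m'. keys m \<subseteq> {1..n} \<longrightarrow> keys m' \<subseteq> {1..n} \<longrightarrow>
    shape m = shape m' \<longrightarrow> lookup f m = lookup f m')"
  have "lookup f (map_key \<pi> m) = lookup f m" if \<pi>: "\<pi> permutes {1..n}" for \<pi> m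
  proof -
    have "keys (map_key \<pi> m) = \<pi> -` keys m"
      using \<pi> by (simp add: keys_map_key permutes_inj)
    \<comment> \<open>Since \<open>\<pi>\<close> preserves \<open>{1..n}\<close>, either both
      monomials lie in the first \<open>n\<close> indeterminates or neither does; in the latter case
      both coefficients are zero.\<close>
    then have "keys (map_key \<pi> m) \<subseteq> {1..n} \<longleftrightarrow> keys m \<subseteq> {1..n}"
      using \<pi> by (metis permutes_vimage permutes_bij bij_is_surj surj_image_vimage_eq
          image_mono permutes_image vimage_mono)
    then show ?thesis
      using f \<pi> polysD[of f n] by (metis permutes_bij shape_map_key)
  qed
  with f show "f \<in> sym_polys n" by (simp add: sym_polys_iff_map_key)
qed

lemma sym_polysI:
  assumes "\<And>m. lookup f m \<noteq> 0 \<Longrightarrow> keys m \<subseteq> {1..n}"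
    and "\<And>m m'. keys m \<subseteq> {1..n} \<Longrightarrow> keys m' \<subseteq> {1..n} \<Longrightarrow> shape m = shape m' \<Longrightarrow> lookup f m = lookup f m'"
  shows "f \<in> sym_polys n"
  unfolding sym_polys_iff_shape using polysI[of f n] assms by blast

lemma sym_polys_shapeD:
  assumes "f \<in> sym_polys n" "keys m \<subseteq> {1..n}" "keys m' \<subseteq> {1..n}" "shape m = shape m'"
  shows "lookup f m = lookup f m'"
  using assms sym_polys_iff_shape by blast

text \<open>Only finitely many values are available for each of \<open>n\<close> exponents: the
  parts of the given shapes, and 0 for absent indeterminates. This ensures finite support in
  \<open>from_shapes\<close>.\<close>

lemma finite_monomials_of_shapes:
  assumes "finite \<S>"
  shows "finite {m. keys m \<subseteq> {1..n} \<and> shape m \<in> \<S>}" (is "finite ?M")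
proof -
  let ?B = "insert 0 (\<Union>S\<in>\<S>. set_mset S)"
  let ?F = "{g. \<forall>i. (i \<in> {1..n} \<longrightarrow> g i \<in> ?B) \<and> (i \<notin> {1..n} \<longrightarrow> g i = 0)}"
  have "finite ?F"
    by (rule finite_set_of_finite_funs) (use assms in auto)
  moreover have "lookup ` ?M \<subseteq> ?F"
  proof clarify
    fix m i assume m: "keys m \<subseteq> {1..n}" "shape m \<in> \<S>"
    have "lookup m i \<in># shape m" if "lookup m i \<noteq> 0"
      using that by (simp add: shape_def in_keys_iff)
    then show "(i \<in> {1..n} \<longrightarrow> lookup m i \<in> ?B) \<and> (i \<notin> {1..n} \<longrightarrow> lookup m i = 0)"
      using m by (auto simp: in_keys_iff subset_iff)
  qed
  ultimately have "finite (lookup ` ?M)" by (rule rev_finite_subset)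
  then show ?thesis
    by (rule finite_imageD) (auto intro!: inj_onI poly_mapping_eqI)
qed

text \<open>For finitely supported \<open>c\<close> this is the linear combination of the monomial
  symmetric polynomials in \<open>n\<close> indeterminates with coefficients \<open>c\<close>. The
  same \<open>c\<close> can be used for every \<open>n\<close>.\<close>

definition from_shapes :: "nat \<Rightarrow> (nat multiset \<Rightarrow> int) \<Rightarrow> int_poly" where
  "from_shapes n c = Abs_poly_mapping (\<lambda>m. if keys m \<subseteq> {1..n} then c (shape m) else 0)"

lemma lookup_from_shapes:
  assumes "finite {S. c S \<noteq> 0}"
  shows "lookup (from_shapes n c) m = (if keys m \<subseteq> {1..n} then c (shape m) else 0)"
proof -
  have "finite {m. (if keys m \<subseteq> {1..n} then c (shape m) else 0) \<noteq> 0}"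
    by (rule finite_subset[OF _ finite_monomials_of_shapes[OF assms, of n]]) (auto split: if_splits)
  then show ?thesis
    unfolding from_shapes_def by (simp add: Abs_poly_mapping_inverse)
qed

lemma from_shapes_in_sym_polys:
  assumes "finite {S. c S \<noteq> 0}"
  shows "from_shapes n c \<in> sym_polys n"
  by (rule sym_polysI) (simp_all add: lookup_from_shapes[OF assms] split: if_splits)

text \<open>The last conclusion records that no new shapes are introduced, so that degrees are still
  under control after passing to more indeterminates.\<close>

lemma sym_polys_eq_from_shapes:
  assumes "f \<in> sym_polys n"
  obtains c where "finite {S. c S \<noteq> 0}" "f = from_shapes n c" "\<And>S. c S \<noteq> 0 \<Longrightarrow> S \<in> shape ` keys f"
proof
  \<comment> \<open>The choice of \<open>m\<close> is harmless because \<open>f\<close> is constant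
    on shapes. The default 0 on shapes not occurring in \<open>f\<close> makes \<open>c\<close>
    finitely supported.\<close>
  define c where "c S = (if S \<in> shape ` keys f then lookup f (SOME m. m \<in> keys f \<and> shape m = S) else 0)" for S
  show c: "S \<in> shape ` keys f" if "c S \<noteq> 0" for S
    using that by (auto simp: c_def split: if_splits)
  show fin: "finite {S. c S \<noteq> 0}"
    by (rule finite_subset[of _ "shape ` keys f"]) (use c in auto)
  have f: "f \<in> polys n" using assms by (simp add: sym_polys_def)
  show "f = from_shapes n c"
  proof (rule poly_mapping_eqI)
    fix m
    show "lookup f m = lookup (from_shapes n c) m"
    proof (cases "keys m \<subseteq> {1..n}")
      case True
      have "lookup f m = c (shape m)"
      proof (cases "shape m \<in> shape ` keys f")
        case in_shapes: True
        define m' where "m' = (SOME m'. m' \<in> keys f \<and> shape m' = shape m)"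
        have "m' \<in> keys f \<and> shape m' = shape m"
          unfolding m'_def by (rule someI_ex) (use in_shapes in force)
        moreover from this have "keys m' \<subseteq> {1..n}" using f by (auto simp: polys_def)
        ultimately have "lookup f m = lookup f m'"
          using sym_polys_shapeD[OF assms True] by simp
        then show ?thesis using in_shapes by (simp add: c_def m'_def)
      next
        case False
        then show ?thesis by (auto simp: c_def in_keys_iff)
      qed
      then show ?thesis using True by (simp add: lookup_from_shapes[OF fin])
    next
      case False
      then show ?thesis by (simp only: lookup_from_shapes[OF fin] polysD[OF f False] if_False)
    qed
  qed
qed


section \<open>The graded ring of symmetric polynomials\<close>

lemma polys_add: "f \<in> polys n \<Longrightarrow> g \<in> polys n \<Longrightarrow> f + g \<in> polys n"
  using Poly_Mapping.keys_add[of f g] unfolding polys_def by blast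

lemma polys_uminus: "f \<in> polys n \<Longrightarrow> - f \<in> polys n"
  by (simp add: polys_def)

lemma polys_mult:
  assumes "f \<in> polys n" "g \<in> polys n"
  shows "f * g \<in> polys n"
  unfolding polys_def
proof clarify
  fix m i assume "m \<in> keys (f * g)" "i \<in> keys m"
  then obtain a b where "m = a + b" "a \<in> keys f" "b \<in> keys g"
    using keys_mult[of f g] by blast
  with \<open>i \<in> keys m\<close> assms show "i \<in> {1..n}"
    using Poly_Mapping.keys_add[of a b] by (fastforce simp: polys_def)
qed

lemma sym_polys_0: "0 \<in> sym_polys n"
  by (simp add: sym_polys_def polys_def)

lemma sym_polys_1: "1 \<in> sym_polys n"
  by (simp add: sym_polys_def polys_def)

lemma sym_polys_add: "f \<in> sym_polys n \<Longrightarrow> g \<in> sym_polys n \<Longrightarrow> f + g \<in> sym_polys n"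
  by (simp add: sym_polys_def polys_add poly_subst_add)

lemma sym_polys_uminus: "f \<in> sym_polys n \<Longrightarrow> - f \<in> sym_polys n"
  by (simp add: sym_polys_def polys_uminus poly_subst_uminus)

lemma sym_polys_mult: "f \<in> sym_polys n \<Longrightarrow> g \<in> sym_polys n \<Longrightarrow> f * g \<in> sym_polys n"
  by (simp add: sym_polys_def polys_mult poly_subst_mult)

lemma homogeneous_add: "homogeneous r f \<Longrightarrow> homogeneous r g \<Longrightarrow> homogeneous r (f + g)"
  using Poly_Mapping.keys_add[of f g] unfolding homogeneous_def by blast

lemma homogeneous_mult:
  assumes "homogeneous r f" "homogeneous s g"
  shows "homogeneous (r + s) (f * g)"
  using assms keys_mult[of f g] by (fastforce simp: homogeneous_shape sum_mset_shape_add)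

lemma sym_homog_0: "0 \<in> sym_homog n r"
  by (simp add: sym_homog_def sym_polys_0 homogeneous_def)

lemma sym_homog_add: "f \<in> sym_homog n r \<Longrightarrow> g \<in> sym_homog n r \<Longrightarrow> f + g \<in> sym_homog n r"
  by (simp add: sym_homog_def sym_polys_add homogeneous_add)

lemma sym_homog_uminus: "f \<in> sym_homog n r \<Longrightarrow> - f \<in> sym_homog n r"
  by (simp add: sym_homog_def sym_polys_uminus homogeneous_def)

lemma sym_homog_mult: "f \<in> sym_homog n r \<Longrightarrow> g \<in> sym_homog n s \<Longrightarrow> f * g \<in> sym_homog n (r + s)"
  by (simp add: sym_homog_def sym_polys_mult homogeneous_mult)

lemma sym_ring_simps [simp]:
  "carrier (sym_ring n) = sym_polys n" "x \<otimes>\<^bsub>sym_ring n\<^esub> y = x * y" "x \<oplus>\<^bsub>sym_ring n\<^esub> y = x + y"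
  "\<one>\<^bsub>sym_ring n\<^esub> = 1" "\<zero>\<^bsub>sym_ring n\<^esub> = 0"
  by (simp_all add: sym_ring_def)

lemma cring_sym_ring: "cring (sym_ring n)"
proof (rule cringI)
  show "abelian_group (sym_ring n)"
    by (rule abelian_groupI)
      (auto simp: sym_polys_0 sym_polys_add algebra_simps intro!: bexI[OF _ sym_polys_uminus])
  show "comm_monoid (sym_ring n)"
    by (rule comm_monoidI) (auto simp: sym_polys_1 sym_polys_mult algebra_simps)
qed (auto simp: algebra_simps)

lemma a_inv_sym_ring:
  assumes "f \<in> sym_polys n"
  shows "\<ominus>\<^bsub>sym_ring n\<^esub> f = - f"
proof -
  interpret cring "sym_ring n" by (rule cring_sym_ring)
  show ?thesis using assms sym_polys_uminus[OF assms] by (intro minus_equality) auto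
qed

text \<open>Translates the sum of the abstract ring into the ordinary sum, in which homogeneous
  decompositions are computed.\<close>

lemma finsum_sym_ring:
  assumes "finite K" "\<And>k. k \<in> K \<Longrightarrow> a k \<in> sym_polys n"
  shows "(\<Oplus>\<^bsub>sym_ring n\<^esub>k\<in>K. a k) = (\<Sum>k\<in>K. a k)"
proof -
  interpret cring "sym_ring n" by (rule cring_sym_ring)
  show ?thesis
    using assms by (induction K) (auto simp: finsum_insert)
qed

lemma additive_subgroup_sym_homog: "additive_subgroup (sym_homog n r) (sym_ring n)"
proof (rule additive_subgroupI, rule subgroup.intro)
  fix f assume "f \<in> sym_homog n r"
  moreover from this have "inv\<^bsub>add_monoid (sym_ring n)\<^esub> f = - f"
    using a_inv_sym_ring[of f n] by (simp add: a_inv_def sym_homog_def)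
  ultimately show "inv\<^bsub>add_monoid (sym_ring n)\<^esub> f \<in> sym_homog n r"
    by (simp add: sym_homog_uminus)
qed (auto simp: sym_homog_0 sym_homog_add, simp add: sym_homog_def)

section \<open>Homogeneous components and the grading\<close>

definition component :: "nat \<Rightarrow> int_poly \<Rightarrow> int_poly" where
  "component r f = Abs_poly_mapping (\<lambda>m. if sum_mset (shape m) = r then lookup f m else 0)"

lemma lookup_component:
  "lookup (component r f) m = (if sum_mset (shape m) = r then lookup f m else 0)"
proof -
  have "finite {m. (if sum_mset (shape m) = r then lookup f m else 0) \<noteq> 0}"
    by (rule finite_subset[OF _ finite_lookup[of f]]) auto
  then show ?thesis
    unfolding component_def by (simp add: Abs_poly_mapping_inverse)
qed

text \<open>Whether a coefficient is kept depends only on the shape of its monomial, so symmetry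
  survives.\<close>

lemma component_in_sym_homog:
  assumes "f \<in> sym_polys n"
  shows "component r f \<in> sym_homog n r"
proof -
  have "component r f \<in> sym_polys n"
  proof (rule sym_polysI)
    show "keys m \<subseteq> {1..n}" if "lookup (component r f) m \<noteq> 0" for m
      using that assms polysD[of f n m]
      by (simp add: sym_polys_def lookup_component split: if_splits) blast
    show "lookup (component r f) m = lookup (component r f) m'"
      if "keys m \<subseteq> {1..n}" "keys m' \<subseteq> {1..n}" "shape m = shape m'" for m m'
      using sym_polys_shapeD[OF assms that] that(3) by (simp add: lookup_component)
  qed
  then show ?thesis
    by (auto simp: sym_homog_def homogeneous_shape in_keys_iff lookup_component split: if_splits)
qed

lemma finite_component: "finite {r. component r f \<noteq> 0}"
proof (rule finite_subset)
  show "{r. component r f \<noteq> 0} \<subseteq> (\<lambda>m. sum_mset (shape m)) ` keys f"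
    by (auto simp: poly_mapping_eq_iff fun_eq_iff lookup_component in_keys_iff image_iff split: if_splits)
qed simp

lemma sum_component: "(\<Sum>r | component r f \<noteq> 0. component r f) = f"
proof (rule poly_mapping_eqI)
  fix m
  let ?d = "sum_mset (shape m)"
  \<comment> \<open>At \<open>m\<close> only the summand of degree \<open>?d\<close> can contribute.
    If it is missing from the index set, the coefficient of \<open>f\<close> must be seen to vanish
    as well.\<close>
  have "lookup f m = 0" if "component ?d f = 0"
    using that lookup_component[of ?d f m] by simp
  then show "lookup (\<Sum>r | component r f \<noteq> 0. component r f) m = lookup f m"
    using finite_component[of f] by (auto simp: lookup_sum lookup_component)
qed

text \<open>At a monomial of degree \<open>d\<close> all summands except \<open>a d\<close> vanish,
  so \<open>f\<close> determines the coefficients of \<open>a d\<close>.\<close>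

lemma component_unique:
  assumes "\<And>r. homogeneous r (a r)" "finite {r. a r \<noteq> 0}" "f = (\<Sum>r | a r \<noteq> 0. a r)"
  shows "a r = component r f"
proof (rule poly_mapping_eqI)
  fix m
  have *: "lookup (a s) m = 0" if "sum_mset (shape m) \<noteq> s" for s
    using assms(1)[of s] that by (auto simp: homogeneous_shape in_keys_iff)
  have "lookup f m = (\<Sum>s | a s \<noteq> 0. if s = sum_mset (shape m) then lookup (a s) m else 0)"
    unfolding assms(3) lookup_sum by (rule sum.cong) (auto simp: *)
  then have "lookup f m = lookup (a (sum_mset (shape m))) m"
    using assms(2) by simp
  then show "lookup (a r) m = lookup (component r f) m"
    by (simp add: lookup_component *)
qed

lemma graded_cring_sym_ring: "graded_cring (sym_ring n) (sym_homog n)"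
proof (intro graded_cring.intro graded_cring_axioms.intro cring_sym_ring)
  show "additive_subgroup (sym_homog n r) (sym_ring n)" for r
    by (rule additive_subgroup_sym_homog)
  show "x \<otimes>\<^bsub>sym_ring n\<^esub> y \<in> sym_homog n (r + s)"
    if "x \<in> sym_homog n r" "y \<in> sym_homog n s" for x y r s
    using that by (simp add: sym_homog_mult)
  fix f assume "f \<in> carrier (sym_ring n)"
  then have f: "f \<in> sym_polys n" by simp
  show "\<exists>!a. (\<forall>r. a r \<in> sym_homog n r) \<and> finite {r. a r \<noteq> \<zero>\<^bsub>sym_ring n\<^esub>} \<and>
      f = (\<Oplus>\<^bsub>sym_ring n\<^esub>r\<in>{r. a r \<noteq> \<zero>\<^bsub>sym_ring n\<^esub>}. a r)"
  proof (rule ex1I[of _ "\<lambda>r. component r f"], intro conjI allI)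
    show "component r f \<in> sym_homog n r" for r
      by (rule component_in_sym_homog[OF f])
    then have "component r f \<in> sym_polys n" for r by (simp add: sym_homog_def)
    then show "f = (\<Oplus>\<^bsub>sym_ring n\<^esub>r\<in>{r. component r f \<noteq> \<zero>\<^bsub>sym_ring n\<^esub>}. component r f)"
      by (simp add: finsum_sym_ring finite_component sum_component)
    show "finite {r. component r f \<noteq> \<zero>\<^bsub>sym_ring n\<^esub>}"
      by (simp add: finite_component)
  next
    fix a assume a: "(\<forall>r. a r \<in> sym_homog n r) \<and> finite {r. a r \<noteq> \<zero>\<^bsub>sym_ring n\<^esub>} \<and>
      f = (\<Oplus>\<^bsub>sym_ring n\<^esub>r\<in>{r. a r \<noteq> \<zero>\<^bsub>sym_ring n\<^esub>}. a r)"
    then have "homogeneous r (a r)" "a r \<in> sym_polys n" for r by (auto simp: sym_homog_def)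
    with a show "a = (\<lambda>r. component r f)"
      by (intro ext component_unique) (auto simp: finsum_sym_ring)
  qed
qed


section \<open>The projection\<close>

text \<open>A monomial is killed as soon as it contains one vanishing indeterminate, since that one
  has a positive exponent; otherwise the substitution acts as the identity permutation.\<close>

lemma mono_subst_sym_proj:
  "mono_subst (\<lambda>i. if i \<in> {n + 1..n + p} then 0 else indet i) m =
    (if keys m \<inter> {n + 1..n + p} = {} then single m 1 else 0)"
proof (cases "keys m \<inter> {n + 1..n + p} = {}")
  case True
  then have "mono_subst (\<lambda>i. if i \<in> {n + 1..n + p} then 0 else indet i) m = mono_subst (\<lambda>i. indet (id i)) m"
    unfolding mono_subst_def by (intro prod.cong) auto
  also have "\<dots> = single m 1"
    using mono_subst_perm[OF bij_id, of m] by (simp add: map_key_id[folded id_def])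
  finally show ?thesis using True by simp
next
  case False
  then obtain i where "i \<in> keys m" "i \<in> {n + 1..n + p}" by blast
  then have "mono_subst (\<lambda>i. if i \<in> {n + 1..n + p} then 0 else indet i) m = 0"
    unfolding mono_subst_def
    by (intro prod_zero) (auto simp: in_keys_iff intro!: bexI[of _ i])
  then show ?thesis using False by simp
qed

text \<open>The projection leaves \<open>x 0\<close> and every \<open>x i\<close> with
  \<open>i > n + p\<close> alone. Confining \<open>f\<close> to \<open>n + p\<close> indeterminates
  turns avoidance of the killed ones into support in \<open>{1..n}\<close>.\<close>

lemma lookup_sym_proj:
  assumes "f \<in> polys (n + p)"
  shows "lookup (sym_proj n p f) m = (if keys m \<subseteq> {1..n} then lookup f m else 0)"
proof -
  have "lookup (sym_proj n p f) m =
      (\<Sum>k\<in>keys f. if k = m then (if keys m \<inter> {n + 1..n + p} = {} then lookup f m else 0) else 0)"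
    unfolding sym_proj_def poly_subst_superset[OF finite_keys order_refl] lookup_sum mono_subst_sym_proj
    by (rule sum.cong) (auto simp: of_int_times_single lookup_single when_def)
  also have "\<dots> = (if keys m \<inter> {n + 1..n + p} = {} then lookup f m else 0)"
    by (simp add: in_keys_iff)
  also have "\<dots> = (if keys m \<subseteq> {1..n} then lookup f m else 0)"
  proof (cases "keys m \<subseteq> {1..n + p}")
    case True
    then have "keys m \<inter> {n + 1..n + p} = {} \<longleftrightarrow> keys m \<subseteq> {1..n}" by fastforce
    then show ?thesis by simp
  next
    case False
    then show ?thesis using polysD[OF assms False] by simp
  qed
  finally show ?thesis .
qed

section \<open>Compatibility of the projection with the graded ring structure\<close>

lemma sym_proj_add: "sym_proj n p (f + g) = sym_proj n p f + sym_proj n p g"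
  by (simp add: sym_proj_def poly_subst_add)

lemma sym_proj_mult: "sym_proj n p (f * g) = sym_proj n p f * sym_proj n p g"
  by (simp add: sym_proj_def poly_subst_mult)

lemma sym_proj_1: "sym_proj n p 1 = 1"
  by (simp add: sym_proj_def)

text \<open>Monomials of equal shape in \<open>n\<close> indeterminates are also such monomials in
  \<open>n + p\<close> indeterminates, where \<open>f\<close> has equal coefficients, and the
  projection keeps these.\<close>

lemma sym_proj_in_sym_polys:
  assumes "f \<in> sym_polys (n + p)"
  shows "sym_proj n p f \<in> sym_polys n"
proof -
  have f: "f \<in> polys (n + p)" using assms by (simp add: sym_polys_def)
  have *: "{1..n} \<subseteq> {1..n + p}" by auto
  show ?thesis
  proof (rule sym_polysI)
    show "keys m \<subseteq> {1..n}" if "lookup (sym_proj n p f) m \<noteq> 0" for m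
      using that by (simp add: lookup_sym_proj[OF f] split: if_splits)
    show "lookup (sym_proj n p f) m = lookup (sym_proj n p f) m'"
      if "keys m \<subseteq> {1..n}" "keys m' \<subseteq> {1..n}" "shape m = shape m'" for m m'
      using that sym_polys_shapeD[OF assms, of m m'] order_trans[OF _ *]
      by (simp add: lookup_sym_proj[OF f])
  qed
qed

lemma sym_proj_in_sym_homog:
  assumes "f \<in> sym_homog (n + p) r"
  shows "sym_proj n p f \<in> sym_homog n r"
proof -
  have "f \<in> polys (n + p)" using assms by (simp add: sym_homog_def sym_polys_def)
  then show ?thesis
    using assms
    by (auto simp: sym_homog_def sym_proj_in_sym_polys homogeneous_def in_keys_iff lookup_sym_proj
        split: if_splits)
qed

lemma sym_proj_from_shapes:
  assumes "finite {S. c S \<noteq> 0}"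
  shows "sym_proj n p (from_shapes (n + p) c) = from_shapes n c"
proof (rule poly_mapping_eqI)
  fix m
  have "from_shapes (n + p) c \<in> polys (n + p)"
    using from_shapes_in_sym_polys[OF assms] by (simp add: sym_polys_def)
  moreover have "{1..n} \<subseteq> {1..n + p}" by auto
  ultimately show "lookup (sym_proj n p (from_shapes (n + p) c)) m = lookup (from_shapes n c) m"
    using assms by (auto simp: lookup_sym_proj lookup_from_shapes)
qed

text \<open>The preimage has the same shape coefficients, read in \<open>n + p\<close>
  indeterminates. The inclusion of shapes makes the same lift work degree by degree.\<close>

lemma sym_proj_preimage:
  assumes "g \<in> sym_polys n"
  obtains f where "f \<in> sym_polys (n + p)" "sym_proj n p f = g" "shape ` keys f \<subseteq> shape ` keys g"
proof -
  from assms obtain c where c: "finite {S. c S \<noteq> 0}" "g = from_shapes n c"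
      "\<And>S. c S \<noteq> 0 \<Longrightarrow> S \<in> shape ` keys g"
    by (rule sym_polys_eq_from_shapes) blast
  show ?thesis
  proof
    show "from_shapes (n + p) c \<in> sym_polys (n + p)"
      by (rule from_shapes_in_sym_polys[OF c(1)])
    show "sym_proj n p (from_shapes (n + p) c) = g"
      by (simp add: sym_proj_from_shapes[OF c(1)] c(2))
    show "shape ` keys (from_shapes (n + p) c) \<subseteq> shape ` keys g"
      by (rule image_subsetI, rule c(3)) (auto simp: in_keys_iff lookup_from_shapes[OF c(1)] split: if_splits)
  qed
qed

lemma sym_proj_surj: "sym_proj n p ` sym_polys (n + p) = sym_polys n"
proof (intro equalityI image_subsetI subsetI)
  show "g \<in> sym_proj n p ` sym_polys (n + p)" if "g \<in> sym_polys n" for g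
    using that by (rule sym_proj_preimage[where p = p]) blast
qed (rule sym_proj_in_sym_polys)

lemma sym_proj_surj_homog: "sym_proj n p ` sym_homog (n + p) r = sym_homog n r"
proof (intro equalityI image_subsetI subsetI)
  fix g assume g: "g \<in> sym_homog n r"
  then have "g \<in> sym_polys n" by (simp add: sym_homog_def)
  then obtain f where f: "f \<in> sym_polys (n + p)" "sym_proj n p f = g" "shape ` keys f \<subseteq> shape ` keys g"
    by (rule sym_proj_preimage)
  have "sum_mset S = r" if "S \<in> shape ` keys g" for S
    using g that by (auto simp: sym_homog_def homogeneous_shape)
  then have "homogeneous r f"
    using f(3) by (auto simp: homogeneous_shape)
  with f show "g \<in> sym_proj n p ` sym_homog (n + p) r"
    by (auto simp: sym_homog_def)
qed (rule sym_proj_in_sym_homog)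

text \<open>A monomial of degree \<open>r \<le> n\<close> has at most \<open>n\<close> parts, so
  some monomial in the first \<open>n\<close> indeterminates has the same shape. By symmetry it has
  the same coefficient, which the projection retains.\<close>

lemma sym_proj_kernel:
  assumes "f \<in> sym_homog (n + p) r" "r \<le> n" "sym_proj n p f = 0"
  shows "f = 0"
proof (rule ccontr)
  assume "f \<noteq> 0"
  then obtain m where m: "m \<in> keys f" by (metis ex_in_conv keys_eq_empty)
  have f: "f \<in> sym_polys (n + p)" "f \<in> polys (n + p)" and "sum_mset (shape m) = r"
    using assms(1) m by (auto simp: sym_homog_def sym_polys_def homogeneous_shape)
  then have "size (shape m) \<le> n"
    using size_le_sum_mset[OF zero_notin_shape, of m] assms(2) by simp
  then obtain m' where m': "keys m' \<subseteq> {1..n}" "shape m' = shape m"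
    using exists_monomial_of_shape[OF zero_notin_shape] by blast
  have "keys m' \<subseteq> {1..n + p}" using m'(1) by fastforce
  moreover have "keys m \<subseteq> {1..n + p}" using f(2) m by (auto simp: polys_def)
  ultimately have "lookup f m = lookup f m'"
    using m'(2) by (intro sym_polys_shapeD[OF f(1)]) auto
  also have "\<dots> = lookup (sym_proj n p f) m'"
    using m'(1) by (simp add: lookup_sym_proj[OF f(2)])
  finally show False using assms(3) m by (simp add: in_keys_iff)
qed

lemma inj_on_sym_proj:
  assumes "r \<le> n"
  shows "inj_on (sym_proj n p) (sym_homog (n + p) r)"
proof (rule inj_onI)
  fix f g assume fg: "f \<in> sym_homog (n + p) r" "g \<in> sym_homog (n + p) r" "sym_proj n p f = sym_proj n p g"
  have "f + - g \<in> sym_homog (n + p) r"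
    using fg by (intro sym_homog_add sym_homog_uminus)
  moreover have "sym_proj n p (f + - g) = 0"
    using fg(3) by (simp add: sym_proj_def poly_subst_add poly_subst_uminus del: add_uminus_conv_diff)
  ultimately show "f = g"
    using sym_proj_kernel[OF _ assms] by fastforce
qed

text \<open>For \<open>r > n\<close> the monomial symmetric polynomial of the partition \<open>(r - n, 1, \<dots>, 1)\<close> with
  \<open>n + 1\<close> parts is in the kernel.\<close>

lemma not_inj_on_sym_proj:
  assumes "p \<ge> 1" "n < r"
  shows "\<not> inj_on (sym_proj n p) (sym_homog (n + p) r)"
proof
  assume inj: "inj_on (sym_proj n p) (sym_homog (n + p) r)"
  \<comment> \<open>As \<open>n < r\<close>, the part \<open>r - n\<close> is positive, so
    \<open>S\<close> has \<open>n + 1\<close> nonzero parts and sum \<open>r\<close>.\<close>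
  define S where "S = add_mset (r - n) (replicate_mset n (1::nat))"
  define c where "c T = (if T = S then 1 else 0 :: int)" for T
  define f where "f = from_shapes (n + p) c"
  have S: "0 \<notin># S" "size S = n + 1" "sum_mset S = r"
    using assms(2) by (auto simp: S_def)
  have c: "finite {T. c T \<noteq> 0}" by (simp add: c_def)
  have lf: "lookup f m = (if keys m \<subseteq> {1..n + p} then c (shape m) else 0)" for m
    by (simp add: f_def lookup_from_shapes[OF c])
  have "f \<in> sym_polys (n + p)"
    unfolding f_def by (rule from_shapes_in_sym_polys[OF c])
  then have "f \<in> sym_homog (n + p) r"
    using S(3) by (auto simp: sym_homog_def homogeneous_shape in_keys_iff lf c_def split: if_splits)
  moreover have "sym_proj n p f = 0"
  proof (rule poly_mapping_eqI)
    fix m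
    \<comment> \<open>In \<open>n\<close> indeterminates a shape has at most \<open>n\<close> parts,
      one too few for \<open>S\<close>.\<close>
    have "shape m \<noteq> S" if "keys m \<subseteq> {1..n}"
      using card_mono[OF _ that] S(2) size_shape[of m] by auto
    then show "lookup (sym_proj n p f) m = lookup 0 m"
      unfolding f_def sym_proj_from_shapes[OF c] lookup_from_shapes[OF c] by (simp add: c_def)
  qed
  moreover have "sym_proj n p 0 = 0" by (simp add: sym_proj_def)
  ultimately have "f = 0"
    using inj sym_homog_0 by (metis inj_onD)
  \<comment> \<open>Here \<open>p \<ge> 1\<close> provides room for \<open>n + 1\<close> parts, so
    \<open>f\<close> has a coefficient equal to 1.\<close>
  obtain m where "keys m \<subseteq> {1..n + p}" "shape m = S"
    using exists_monomial_of_shape[OF S(1), of "n + p"] S(2) assms(1) by auto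
  then show False
    using lf[of m] \<open>f = 0\<close> by (simp add: c_def)
qed

lemma graded_cring_hom_sym_proj:
  "graded_cring_hom (sym_ring (n + p)) (sym_homog (n + p)) (sym_ring n) (sym_homog n) (sym_proj n p)"
proof (intro graded_cring_hom.intro graded_cring_hom_axioms.intro graded_cring_sym_ring
    ring_hom_cring.intro cring_sym_ring ring_hom_cring_axioms.intro ring_hom_memI)
qed (auto simp: sym_proj_in_sym_polys sym_proj_in_sym_homog sym_proj_add sym_proj_mult sym_proj_1)

lemma sym_homog_group_simps [simp]:
  "carrier (sym_homog_group n r) = sym_homog n r" "x \<otimes>\<^bsub>sym_homog_group n r\<^esub> y = x + y"
  by (simp_all add: sym_homog_group_def)

theorem corollary1:
  fixes n p :: nat
  assumes "p \<ge> 1"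
  shows "graded_cring_hom (sym_ring (n + p)) (sym_homog (n + p)) (sym_ring n) (sym_homog n) (sym_proj n p)
    \<and> sym_proj n p ` carrier (sym_ring (n + p)) = carrier (sym_ring n)
    \<and> (\<forall>r. restrict (sym_proj n p) (sym_homog (n + p) r)
              \<in> epi (sym_homog_group (n + p) r) (sym_homog_group n r))
    \<and> (\<forall>r. restrict (sym_proj n p) (sym_homog (n + p) r)
              \<in> iso (sym_homog_group (n + p) r) (sym_homog_group n r) \<longleftrightarrow> r \<le> n)"
proof (intro conjI allI)
  show "graded_cring_hom (sym_ring (n + p)) (sym_homog (n + p)) (sym_ring n) (sym_homog n) (sym_proj n p)"
    by (rule graded_cring_hom_sym_proj)
  show "sym_proj n p ` carrier (sym_ring (n + p)) = carrier (sym_ring n)"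
    by (simp add: sym_proj_surj)
  fix r
  have hom: "restrict (sym_proj n p) (sym_homog (n + p) r) \<in>
      hom (sym_homog_group (n + p) r) (sym_homog_group n r)"
    by (rule homI) (auto simp: sym_proj_in_sym_homog sym_homog_add sym_proj_add)
  then show "restrict (sym_proj n p) (sym_homog (n + p) r)
      \<in> epi (sym_homog_group (n + p) r) (sym_homog_group n r)"
    by (simp add: epi_def sym_proj_surj_homog)
  \<comment> \<open>Surjectivity in every degree reduces bijectivity to injectivity.\<close>
  have "restrict (sym_proj n p) (sym_homog (n + p) r)
      \<in> iso (sym_homog_group (n + p) r) (sym_homog_group n r) \<longleftrightarrow>
      inj_on (sym_proj n p) (sym_homog (n + p) r)"
    using hom by (simp add: iso_def bij_betw_def sym_proj_surj_homog inj_on_restrict_eq)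
  also have "\<dots> \<longleftrightarrow> r \<le> n"
    using inj_on_sym_proj not_inj_on_sym_proj[OF assms] by (meson not_le)
  finally show "restrict (sym_proj n p) (sym_homog (n + p) r)
      \<in> iso (sym_homog_group (n + p) r) (sym_homog_group n r) \<longleftrightarrow> r \<le> n" .
qed

end
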